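(* For any prime $p>3$ and any positive integer $a$, we have $$\frac{T_{p^a}-T_{p^{a-1}}}{p^{2a}}\equiv\frac16\left(\frac p3\right)^aB_{p-2}\left(\frac13\right)\pmod p.$$
   Context: For each integer $m\ge 0$, the central trinomial coefficient $T_m$ is the coefficient of $x^m$ in the expansion of $(x^2+x+1)^m$; equivalently $T_m=\sum_{k=0}^{\lfloor m/2\rfloor}\binom{m}{2k}\binom{2k}{k}$. $\left(\frac p3\right)$ is the Legendre symbol (equal to $1$ if $p\equiv1\pmod 3$ and $-1$ if $p\equiv 2\pmod 3$). $B_m(x)$ is the Bernoulli polynomial of degree $m$, defined by $\frac{te^{xt}}{e^t-1}=\sum_{m\ge0}B_m(x)\frac{t^m}{m!}$. $\mathbb Z_p$ denotes the ring of $p$-adic integers, and for rational numbers $u,v$ the congruence $u\equiv v\pmod p$ means $u-v\in p\mathbb Z_p$. *)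

theory Defs
  imports
    "HOL-Number_Theory.Residues"
    "HOL-Computational_Algebra.Computational_Algebra"
begin

definition central_trinomial :: "nat \<Rightarrow> int" where
  "central_trinomial m = Polynomial.coeff ([:1, 1, 1:] ^ m) m"

definition bernoulli_gf :: "rat \<Rightarrow> rat fps" where
  "bernoulli_gf x = fps_X * fps_exp x / (fps_exp 1 - 1)"

definition bernoulli_poly :: "nat \<Rightarrow> rat \<Rightarrow> rat" where
  "bernoulli_poly m x = fact m * fps_nth (bernoulli_gf x) m"

text \<open>The quotient in \<^const>\<open>bernoulli_gf\<close> is exact: the constant terms of numerator and
  denominator both vanish, and \<open>e\<^sup>t - 1\<close> has subdegree 1.\<close>

lemma bernoulli_poly_gf:
  "Abs_fps (\<lambda>m. bernoulli_poly m x / fact m) * (fps_exp 1 - 1) = fps_X * fps_exp x"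
proof -
  have nz: "fps_nth (fps_exp (1::rat) - 1) 1 \<noteq> 0"
    by simp
  have nz': "fps_exp (1::rat) - 1 \<noteq> 0"
    using nz by (metis fps_zero_nth)
  have sd: "subdegree (fps_exp (1::rat) - 1) \<le> 1"
    using nz by (rule subdegree_leI)
  have "subdegree (fps_X * fps_exp x) \<ge> 1"
    by (rule subdegree_geI) (auto simp: fps_eq_iff fps_X_def intro!: exI[of _ 1])
  with sd have "subdegree (fps_exp (1::rat) - 1) \<le> subdegree (fps_X * fps_exp x)"
    by linarith
  with nz' have "(fps_exp 1 - 1) dvd (fps_X * fps_exp x)"
    using fps_dvd_iff[of "fps_exp (1::rat) - 1" "fps_X * fps_exp x"]
    by (cases "fps_X * fps_exp x = 0") simp_all
  moreover have "Abs_fps (\<lambda>m. bernoulli_poly m x / fact m) = bernoulli_gf x"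
    by (simp add: fps_eq_iff bernoulli_poly_def)
  ultimately show ?thesis
    by (simp add: bernoulli_gf_def)
qed

definition padic_val :: "nat \<Rightarrow> rat \<Rightarrow> int" where
  "padic_val p r = int (multiplicity (int p) (fst (quotient_of r)))
                 - int (multiplicity (int p) (snd (quotient_of r)))"

definition padic_abs :: "nat \<Rightarrow> rat \<Rightarrow> real" where
  "padic_abs p r = (if r = 0 then 0 else real p powi (- padic_val p r))"

text \<open>The \<open>p\<close>-adic integers are the elements of absolute value at most 1 in the completion of the
  rationals with respect to \<^const>\<open>padic_abs\<close>. Only rational numbers are compared below, so only
  the rational \<open>p\<close>-adic integers are needed; the absolute value of the completion extends
  \<^const>\<open>padic_abs\<close>.\<close>

definition padic_int_rats :: "nat \<Rightarrow> rat set" where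
  "padic_int_rats p = {r. padic_abs p r \<le> 1}"

lemma padic_int_rats_iff:
  assumes "prime p"
  shows "r \<in> padic_int_rats p \<longleftrightarrow> \<not> int p dvd snd (quotient_of r)"
proof (cases "r = 0")
  case True
  with assms show ?thesis
    by (auto simp: padic_int_rats_def padic_abs_def dest: prime_gt_1_nat)
next
  case False
  obtain a b where ab: "quotient_of r = (a, b)"
    by (cases "quotient_of r")
  have b: "b > 0" and cop: "coprime a b" and r: "r = of_int a / of_int b"
    using quotient_of_denom_pos[OF ab] quotient_of_coprime[OF ab] quotient_of_div[OF ab]
    by auto
  have a: "a \<noteq> 0"
    using False r by auto
  have p1: "real p > 1" and pr: "prime (int p)"
    using assms prime_gt_1_nat by auto
  have "real p powi (- padic_val p r) \<le> 1 \<longleftrightarrow> - padic_val p r \<le> 0"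
    using power_int_strict_increasing[of 0 "- padic_val p r" "real p"]
      power_int_increasing[of "- padic_val p r" 0 "real p"] p1
    by (metis linorder_not_le order_less_imp_le power_int_0_right)
  hence *: "r \<in> padic_int_rats p \<longleftrightarrow> multiplicity (int p) b \<le> multiplicity (int p) a"
    using False by (simp add: padic_int_rats_def padic_abs_def padic_val_def ab)
  have **: "multiplicity (int p) c > 0 \<longleftrightarrow> int p dvd c" if "c \<noteq> 0" for c
    using that pr by (simp add: prime_multiplicity_gt_zero_iff)
  show ?thesis
  proof (cases "int p dvd b")
    case True
    with cop pr have "\<not> int p dvd a"
      using not_coprimeI not_prime_unit by blast
    with True show ?thesis
      using * **[of a] **[of b] a b by (simp add: ab)
  next
    case False
    thus ?thesis
      using * **[of b] b by (simp add: ab)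
  qed
qed

definition rat_cong :: "rat \<Rightarrow> rat \<Rightarrow> nat \<Rightarrow> bool" where
  "rat_cong u v p \<longleftrightarrow> u - v \<in> (\<lambda>z. of_nat p * z) ` padic_int_rats p"

end

theory Submission
  imports Defs
begin

text \<open>
  Since \<open>1 + x + x\<^sup>2 = (1 - x\<^sup>3) / (1 - x)\<close>, comparing coefficients gives an alternating formula
  \<open>T\<^sub>n = \<Sum> t(n, k)\<close> over \<open>3 k \<le> n\<close>, where
  \<open>t(n, k) = (-1)\<^sup>k binom(n, k) binom(2n - 3k - 1, n - 1)\<close> (\<open>central_trinomial_alternating\<close>).
  Absorbing factors in both binomial coefficients shows that, for \<open>0 < 3k < n\<close>, the term is
  \<open>n\<^sup>2 / (k (n - 3k))\<close> times an integer. For \<open>n = p\<^sup>a\<close> this produces the denominator \<open>p\<^bsup>2a\<^esup>\<close>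
  of the theorem and divides the terms into two classes.

  If \<open>p\<close> does not divide \<open>k\<close>, then the integer is congruent to \<open>-1\<close> modulo \<open>p\<close>, so that
  \<open>t(n, k) / n\<^sup>2\<close> is congruent to \<open>1 / (3 k\<^sup>2)\<close> (\<open>trinomial_term_coprime\<close>).
  If \<open>k = p q\<close>, then \<open>t(n, p q)\<close> cancels against the term \<open>t(n/p, q)\<close> of \<open>T\<^bsub>n/p\<^esub>\<close> modulo
  \<open>p\<^bsup>2a + 1\<^esup>\<close> (\<open>trinomial_term_mult_p_pcong\<close>). This rests on a congruence of Jacobsthal type:
  \<open>binom(p m, p k)\<close> and \<open>binom(m, k)\<close> differ by a factor that is 1 modulo \<open>p\<^bsup>3 + 2v\<^esup>\<close> when \<open>p\<^sup>v\<close>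
  divides both \<open>m\<close> and \<open>k\<close> (\<open>binomial_mult_p\<close>, \<open>block_ratio_pcong\<close>). Such a precise factor is
  needed because \<open>t(n/p, q)\<close> loses a power \<open>p\<^bsup>2v\<^esup>\<close> through its denominator, with \<open>p\<^sup>v\<close>
  the exact power of \<open>p\<close> in \<open>q\<close>.

  What remains is a third of the sum of \<open>1 / k\<^sup>2\<close> over \<open>k \<le> n/3\<close> prime to \<open>p\<close>. By Fermat, it is congruent
  to a sum of powers \<open>k\<^bsup>p - 3\<^esup>\<close>, that is, to \<open>- B\<^bsub>p - 2\<^esub>(\<lfloor>n/3\<rfloor> + 1) / 2\<close>
  (\<open>sum_inverse_squares_pcong\<close>). The coefficients of this polynomial are \<open>p\<close>-integral, so its argument
  may be reduced modulo \<open>p\<close>: it becomes \<open>2/3\<close> or \<open>1/3\<close> as \<open>n\<close> is 1 or 2 modulo 3. The symmetry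
  of \<open>B\<^bsub>p - 2\<^esub>\<close> about \<open>1/2\<close> turns this alternative into the sign \<open>(p/3)\<^sup>a\<close>
  (\<open>sum_inverse_squares_third\<close>).
\<close>

section \<open>Congruences of rational numbers modulo powers of a prime\<close>

text \<open>Any representation as a fraction with denominator prime to \<open>p\<close> witnesses \<open>p\<close>-integrality; it
  need not be in lowest terms. This makes closure under the ring operations immediate.\<close>

lemma padic_int_rats_alt:
  assumes "prime p"
  shows "r \<in> padic_int_rats p \<longleftrightarrow> (\<exists>a b. \<not> int p dvd b \<and> r = of_int a / of_int b)"
proof
  assume "r \<in> padic_int_rats p"
  then have "\<not> int p dvd snd (quotient_of r)"
    using assms by (simp add: padic_int_rats_iff)
  moreover have "r = of_int (fst (quotient_of r)) / of_int (snd (quotient_of r))"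
    by (metis prod.collapse quotient_of_div)
  ultimately show "\<exists>a b. \<not> int p dvd b \<and> r = of_int a / of_int b"
    by blast
next
  assume "\<exists>a b. \<not> int p dvd b \<and> r = of_int a / of_int b"
  then obtain a b where b: "\<not> int p dvd b" and r: "r = of_int a / of_int b"
    by blast
  obtain c d where cd: "quotient_of r = (c, d)"
    by (cases "quotient_of r")
  have d: "d > 0" and cop: "coprime c d" and r': "r = of_int c / of_int d"
    using quotient_of_denom_pos[OF cd] quotient_of_coprime[OF cd] quotient_of_div[OF cd]
    by auto
  have "b \<noteq> 0"
    using b by auto
  have "(of_int (a * d) :: rat) = of_int (c * b)"
    using r r' d \<open>b \<noteq> 0\<close> by (simp add: field_simps)
  then have "a * d = c * b"
    by (simp only: of_int_eq_iff)
  then have "d dvd c * b"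
    by (metis dvd_triv_right)
  then have "d dvd b"
    using cop by (metis coprime_commute coprime_dvd_mult_right_iff)
  then have "\<not> int p dvd d"
    using b dvd_trans by blast
  then show "r \<in> padic_int_rats p"
    using assms by (simp add: padic_int_rats_iff cd)
qed

locale prime_above_3 =
  fixes p :: nat
  assumes prime_p: "prime p" and p_gt_3: "p > 3"
begin

abbreviation Z :: "rat set" where "Z \<equiv> padic_int_rats p"

lemmas Z_iff = padic_int_rats_alt[OF prime_p]

lemma prime_int_p: "prime (int p)"
  using prime_p by simp

lemma Z_of_int [simp, intro]: "of_int a \<in> Z"
  unfolding Z_iff using prime_int_p by (intro exI[of _ a] exI[of _ 1]) auto

lemma Z_of_nat [simp, intro]: "of_nat n \<in> Z"
  using Z_of_int[of "int n"] by simp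

lemma Z_0 [simp, intro]: "0 \<in> Z" and Z_1 [simp, intro]: "1 \<in> Z"
  using Z_of_nat[of 0] Z_of_nat[of 1] by simp_all

lemma Z_add [simp, intro]: "x + y \<in> Z" if xy: "x \<in> Z" "y \<in> Z"
proof -
  obtain a b c d where "\<not> int p dvd b" "x = of_int a / of_int b"
    "\<not> int p dvd d" "y = of_int c / of_int d"
    using xy Z_iff by blast
  moreover from this have "b \<noteq> 0" "d \<noteq> 0"
    by auto
  ultimately have "\<not> int p dvd b * d" "x + y = of_int (a * d + c * b) / of_int (b * d)"
    using prime_int_p by (simp_all add: prime_dvd_mult_iff add_frac_eq)
  then show ?thesis
    unfolding Z_iff by blast
qed

lemma Z_mult [simp, intro]: "x * y \<in> Z" if xy: "x \<in> Z" "y \<in> Z"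
proof -
  obtain a b c d where "\<not> int p dvd b" "x = of_int a / of_int b"
    "\<not> int p dvd d" "y = of_int c / of_int d"
    using xy Z_iff by blast
  then have "\<not> int p dvd b * d" "x * y = of_int (a * c) / of_int (b * d)"
    using prime_int_p by (simp_all add: prime_dvd_mult_iff)
  then show ?thesis
    unfolding Z_iff by blast
qed

lemma Z_uminus [simp, intro]: "- x \<in> Z" if "x \<in> Z"
  using Z_mult[OF Z_of_int[of "-1"] that] by simp

lemma Z_diff [simp, intro]: "x - y \<in> Z" if "x \<in> Z" "y \<in> Z"
  using Z_add[OF that(1) Z_uminus[OF that(2)]] by simp

lemma Z_power [simp, intro]: "x ^ n \<in> Z" if "x \<in> Z"
  using that by (induction n) auto

lemma Z_sum [intro]: "(\<And>i. i \<in> A \<Longrightarrow> f i \<in> Z) \<Longrightarrow> sum f A \<in> Z"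
  by (induction A rule: infinite_finite_induct) auto

lemma Z_prod [intro]: "(\<And>i. i \<in> A \<Longrightarrow> f i \<in> Z) \<Longrightarrow> prod f A \<in> Z"
  by (induction A rule: infinite_finite_induct) auto

lemma Z_inverse_int [intro]: "1 / of_int b \<in> Z" if "\<not> int p dvd b"
  unfolding Z_iff using that by (intro exI[of _ 1] exI[of _ b]) auto

lemma Z_inverse_nat [intro]: "1 / of_nat b \<in> Z" if "\<not> p dvd b"
  using Z_inverse_int[of "int b"] that by simp

lemma Z_divide_nat [intro]: "x / of_nat b \<in> Z" if "x \<in> Z" "\<not> p dvd b"
  using Z_mult[OF that(1) Z_inverse_nat[OF that(2)]] by simp

text \<open>The congruence modulo \<open>p\<^sup>e Z\<close> is not restricted to elements of \<open>Z\<close>: the quotient in the main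
  theorem is only seen to be \<open>p\<close>-integral as a consequence of the congruence.\<close>

definition pcong :: "nat \<Rightarrow> rat \<Rightarrow> rat \<Rightarrow> bool" where
  "pcong e u v \<longleftrightarrow> (\<exists>z\<in>Z. u - v = of_nat p ^ e * z)"

lemma pcongI: "z \<in> Z \<Longrightarrow> u - v = of_nat p ^ e * z \<Longrightarrow> pcong e u v"
  unfolding pcong_def by blast

lemma rat_cong_iff_pcong: "rat_cong u v p \<longleftrightarrow> pcong 1 u v"
  unfolding rat_cong_def pcong_def by auto

lemma pcong_refl [simp, intro]: "pcong e u u"
  by (rule pcongI[of 0]) auto

lemma pcong_sym: "pcong e u v \<Longrightarrow> pcong e v u"
  unfolding pcong_def
  by (metis Z_uminus minus_diff_eq mult_minus_right)

lemma pcong_add: "pcong e (u + x) (v + y)" if "pcong e u v" "pcong e x y"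
proof -
  obtain z w where "z \<in> Z" "w \<in> Z" "u - v = of_nat p ^ e * z" "x - y = of_nat p ^ e * w"
    using \<open>pcong e u v\<close> \<open>pcong e x y\<close> unfolding pcong_def by blast
  then show ?thesis
    by (intro pcongI[of "z + w"]) (auto simp: algebra_simps)
qed

lemma pcong_trans [trans]: "pcong e u w" if "pcong e u v" "pcong e v w"
  using pcong_add[OF that] by (auto simp: pcong_def algebra_simps)

text \<open>These rules let chains mix equations and congruences by first-order unification, instead of
  substitution at an arbitrary position of a large sum or product.\<close>

lemma pcong_eq_trans1 [trans]: "u = v \<Longrightarrow> pcong e v w \<Longrightarrow> pcong e u w"
  and pcong_eq_trans2 [trans]: "pcong e u v \<Longrightarrow> v = w \<Longrightarrow> pcong e u w"
  by simp_all

lemma pcong_cmult: "pcong e (c * u) (c * v)" if "pcong e u v" "c \<in> Z"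
proof -
  obtain z where "z \<in> Z" "u - v = of_nat p ^ e * z"
    using \<open>pcong e u v\<close> unfolding pcong_def by blast
  then show ?thesis
    using \<open>c \<in> Z\<close> by (intro pcongI[of "c * z"]) (auto simp: algebra_simps)
qed

lemma pcong_mult: "pcong e (u * x) (v * y)"
  if "pcong e u v" "pcong e x y" "x \<in> Z" "v \<in> Z"
  using pcong_trans[OF pcong_cmult[OF that(1,3)]] pcong_cmult[OF that(2,4)]
  by (simp add: mult.commute)

lemma pcong_sum: "(\<And>i. i \<in> A \<Longrightarrow> pcong e (f i) (g i)) \<Longrightarrow> pcong e (sum f A) (sum g A)"
  by (induction A rule: infinite_finite_induct) (auto intro: pcong_add)

lemma pcong_prod:
  "(\<And>i. i \<in> A \<Longrightarrow> pcong e (f i) (g i)) \<Longrightarrow> (\<And>i. i \<in> A \<Longrightarrow> f i \<in> Z) \<Longrightarrow>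
    (\<And>i. i \<in> A \<Longrightarrow> g i \<in> Z) \<Longrightarrow> pcong e (prod f A) (prod g A)"
  by (induction A rule: infinite_finite_induct) (auto intro!: pcong_mult Z_prod)

lemma pcong_power: "pcong e u v \<Longrightarrow> u \<in> Z \<Longrightarrow> v \<in> Z \<Longrightarrow> pcong e (u ^ n) (v ^ n)"
  by (induction n) (auto intro!: pcong_mult)

lemma pcong_0_iff: "pcong e u 0 \<longleftrightarrow> (\<exists>z\<in>Z. u = of_nat p ^ e * z)"
  by (simp add: pcong_def)

lemma pcong_of_nat_0: "p ^ e dvd n \<Longrightarrow> pcong e (of_nat n) 0"
  unfolding pcong_0_iff by (metis Z_of_nat dvdE of_nat_mult of_nat_power)

lemma pcong_int: "pcong 1 (of_int x) (of_int y)" if cong: "[x = y] (mod int p)"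
proof -
  obtain k where "x - y = int p * k"
    using cong unfolding cong_iff_dvd_diff dvd_def by blast
  then have "(of_int x - of_int y :: rat) = of_int (int p * k)"
    by (metis of_int_diff)
  then show ?thesis
    by (intro pcongI[of "of_int k"]) auto
qed

end

section \<open>Alternating form of the central trinomial coefficients\<close>

text \<open>The binomial series of \<open>(1 - X)\<^bsup>-s-1\<^esup>\<close>: multiplying by \<open>1 - X\<close> takes differences of consecutive
  coefficients, and by Pascal's rule this lowers \<open>s\<close> by one.\<close>

lemma inverse_power_one_minus_fps_X:
  "(1 - fps_X) ^ Suc s * Abs_fps (\<lambda>j. of_nat ((s + j) choose s)) = (1 :: int fps)"
proof (induction s)
  case 0
  have "(1 - fps_X) * Abs_fps (\<lambda>j. 1) = (1 :: int fps)"
    by (rule fps_ext) (auto simp: algebra_simps)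
  then show ?case
    by simp
next
  case (Suc s)
  have pascal: "Suc (s + j) choose Suc s = (s + j choose Suc s) + (s + j choose s)" for j
    by simp
  have "(1 - fps_X) * Abs_fps (\<lambda>j. of_nat ((Suc s + j) choose Suc s)) =
      (Abs_fps (\<lambda>j. of_nat ((s + j) choose s)) :: int fps)"
  proof (rule fps_ext)
    fix j
    show "((1 - fps_X) * Abs_fps (\<lambda>j. of_nat ((Suc s + j) choose Suc s))) $ j =
      (Abs_fps (\<lambda>j. of_nat ((s + j) choose s)) :: int fps) $ j"
      by (cases j) (simp_all add: algebra_simps pascal)
  qed
  then show ?case
    using Suc by (metis (no_types, lifting) mult.assoc mult.commute power_Suc)
qed

lemma geometric_3: "(1 + x + x ^ 2) * (1 - x) = 1 - x ^ 3" for x :: "'a :: comm_ring_1"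
  by (simp add: algebra_simps power2_eq_square power3_eq_cube)

definition trinomial_term :: "nat \<Rightarrow> nat \<Rightarrow> int" where
  "trinomial_term n k = (-1) ^ k * int (n choose k) * int ((2 * n - 3 * k - 1) choose (n - 1))"

text \<open>The coefficient of \<open>X\<^sup>n\<close> in \<open>(1 - X\<^sup>3)\<^sup>n (1 - X)\<^bsup>-n\<^esup>\<close>: the binomial theorem expands the first
  factor, and the binomial series the second. The point of this form is that, for \<open>0 < 3k < n\<close>,
  each of the two binomial coefficients of a term contributes a factor \<open>n\<close>, up to a denominator \<open>k\<close> or
  \<open>n - 3k\<close>.\<close>

theorem central_trinomial_alternating:
  assumes "n > 0"
  shows "central_trinomial n = (\<Sum>k | 3 * k \<le> n. trinomial_term n k)"
proof -
  obtain s where n: "n = Suc s"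
    using assms by (cases n) auto
  define G :: "int fps" where "G = Abs_fps (\<lambda>j. of_nat ((s + j) choose s))"
  have G: "(1 - fps_X) ^ n * G = 1"
    unfolding G_def n by (rule inverse_power_one_minus_fps_X)
  have poly: "fps_of_poly [:1, 1, 1 :: int:] = 1 + fps_X + fps_X ^ 2"
    by (simp add: fps_of_poly_pCons algebra_simps power2_eq_square)
  have "(1 + fps_X + fps_X ^ 2 :: int fps) ^ n * (1 - fps_X) ^ n = (1 - fps_X ^ 3) ^ n"
    by (subst geometric_3 [symmetric]) (rule power_mult_distrib [symmetric])
  then have *: "(1 + fps_X + fps_X ^ 2 :: int fps) ^ n = (1 - fps_X ^ 3) ^ n * G"
    using G by (metis mult.assoc mult.right_neutral)
  have **: "(1 - fps_X ^ 3 :: int fps) ^ n = (\<Sum>k\<le>n. of_int ((-1) ^ k * int (n choose k)) * fps_X ^ (3 * k))"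
    using binomial_ring[of "- (fps_X ^ 3) :: int fps" 1 n]
    by (simp add: power_minus[of "fps_X ^ 3"] power_mult[symmetric] mult_ac)
  have "central_trinomial n = fps_of_poly ([:1, 1, 1:] ^ n) $ n"
    by (simp add: central_trinomial_def)
  also have "\<dots> = ((1 - fps_X ^ 3) ^ n * G) $ n"
    by (simp add: fps_of_poly_power poly *)
  also have "\<dots> = (\<Sum>k\<le>n. (of_int ((-1) ^ k * int (n choose k)) * (fps_X ^ (3 * k) * G)) $ n)"
    unfolding ** by (simp add: sum_distrib_right fps_sum_nth mult.assoc)
  also have "\<dots> = (\<Sum>k\<le>n. (-1) ^ k * int (n choose k) * (fps_X ^ (3 * k) * G) $ n)"
    by (intro sum.cong refl) (simp only: fps_of_int [symmetric] fps_mult_left_const_nth of_int_eq_id id_apply)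
  also have "\<dots> = (\<Sum>k | 3 * k \<le> n. (-1) ^ k * int (n choose k) * (fps_X ^ (3 * k) * G) $ n)"
    by (rule sum.mono_neutral_right) (auto simp: fps_X_power_mult_nth)
  also have "\<dots> = (\<Sum>k | 3 * k \<le> n. trinomial_term n k)"
    by (intro sum.cong refl)
       (auto simp: fps_X_power_mult_nth trinomial_term_def G_def n intro!: arg_cong2[of _ _ _ _ binomial])
  finally show ?thesis .
qed

section \<open>Bernoulli polynomials\<close>

lemma bernoulli_gf_mult: "bernoulli_gf x * (fps_exp 1 - 1) = fps_X * fps_exp x"
proof -
  have "Abs_fps (\<lambda>m. bernoulli_poly m x / fact m) = bernoulli_gf x"
    by (simp add: fps_eq_iff bernoulli_poly_def)
  then show ?thesis
    using bernoulli_poly_gf[of x] by simp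
qed

text \<open>The basic identities for Bernoulli polynomials all follow by multiplying both sides with
  \<open>e\<^sup>t - 1\<close>, which is not a zero divisor.\<close>

lemma bernoulli_gf_unique:
  assumes "f * (fps_exp 1 - 1) = fps_X * fps_exp x"
  shows "f = bernoulli_gf x"
proof -
  have "fps_nth (fps_exp 1 - 1 :: rat fps) 1 \<noteq> fps_nth 0 1"
    by simp
  then have "fps_exp 1 - 1 \<noteq> (0 :: rat fps)"
    by metis
  then show ?thesis
    using assms bernoulli_gf_mult[of x] by (metis mult_right_cancel)
qed

lemma bernoulli_gf_add_1: "bernoulli_gf (x + 1) = bernoulli_gf x + fps_X * fps_exp x"
  by (rule bernoulli_gf_unique [symmetric])
     (simp only: distrib_right bernoulli_gf_mult fps_exp_add_mult, simp add: algebra_simps)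

lemma bernoulli_gf_expand: "bernoulli_gf x = bernoulli_gf 0 * fps_exp x"
  by (rule bernoulli_gf_unique [symmetric])
     (metis bernoulli_gf_mult fps_exp_0 mult.assoc mult.commute mult_1)

text \<open>Substituting \<open>-t\<close> for \<open>t\<close> in \<open>t e\<^bsup>xt\<^esup> / (e\<^sup>t - 1)\<close> gives \<open>-t e\<^bsup>-xt\<^esup> / (e\<^bsup>-t\<^esup> - 1)\<close>; expanding the
  fraction by \<open>e\<^sup>t\<close> yields \<open>t e\<^bsup>(1 - x)t\<^esup> / (e\<^sup>t - 1)\<close>.\<close>

lemma bernoulli_gf_reflect:
  "bernoulli_gf (1 - x) = fps_compose (bernoulli_gf x) (fps_const (-1) * fps_X)"
proof (rule bernoulli_gf_unique [symmetric])
  let ?C = "\<lambda>f :: rat fps. fps_compose f (fps_const (-1) * fps_X)"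
  have "?C (bernoulli_gf x) * ?C (fps_exp 1 - 1) = ?C (bernoulli_gf x * (fps_exp 1 - 1))"
    by (rule fps_compose_mult_distrib [symmetric]) simp
  also have "\<dots> = ?C fps_X * ?C (fps_exp x)"
    unfolding bernoulli_gf_mult by (rule fps_compose_mult_distrib) simp
  also have "?C (fps_exp 1 - 1) = fps_exp (-1) - 1"
    by (simp add: fps_compose_sub_distrib fps_exp_compose_linear del: fps_const_neg)
  also have "?C (fps_exp x) = fps_exp (-x)"
    by (subst fps_exp_compose_linear) simp
  also have "?C fps_X = - fps_X"
    unfolding fps_compose_linear by (rule fps_ext) (auto simp: fps_X_nth)
  finally have C: "?C (bernoulli_gf x) * (fps_exp (-1) - 1) = - fps_X * fps_exp (-x)" .
  have inv: "fps_exp (-1) * fps_exp 1 = (1 :: rat fps)"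
    by (simp flip: fps_exp_add_mult)
  have "?C (bernoulli_gf x) * (fps_exp 1 - 1) =
      - (?C (bernoulli_gf x) * (fps_exp (-1) - 1) * fps_exp 1)"
    using inv by (simp add: algebra_simps)
  also have "\<dots> = fps_X * (fps_exp (-x) * fps_exp 1)"
    unfolding C by (simp add: mult.assoc)
  also have "fps_exp (-x) * fps_exp 1 = fps_exp (1 - x)"
    by (simp flip: fps_exp_add_mult)
  finally show "?C (bernoulli_gf x) * (fps_exp 1 - 1) = fps_X * fps_exp (1 - x)" .
qed

lemma bernoulli_poly_reflect: "bernoulli_poly m (1 - x) = (-1) ^ m * bernoulli_poly m x"
  unfolding bernoulli_poly_def bernoulli_gf_reflect fps_compose_linear by simp

lemma bernoulli_poly_add_1:
  "bernoulli_poly (Suc s) (x + 1) = bernoulli_poly (Suc s) x + of_nat (Suc s) * x ^ s"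
  unfolding bernoulli_poly_def bernoulli_gf_add_1 by (simp add: field_simps del: of_nat_Suc)

text \<open>Faulhaber's formula, by telescoping the difference equation.\<close>

lemma sum_powers_bernoulli_poly:
  "of_nat (Suc s) * (\<Sum>k<N. of_nat k ^ s) = bernoulli_poly (Suc s) (of_nat N) - bernoulli_poly (Suc s) 0"
proof (induction N)
  case (Suc N)
  then show ?case
    using bernoulli_poly_add_1[of s "of_nat N"]
    by (simp add: ring_distribs add.commute del: of_nat_Suc) (simp add: add.commute)
qed simp

text \<open>The difference equation gives \<open>B\<^sub>m(1) = B\<^sub>m(0)\<close>, the reflection \<open>B\<^sub>m(1) = - B\<^sub>m(0)\<close>.\<close>

lemma bernoulli_poly_odd_0: "bernoulli_poly m 0 = 0" if "odd m" "m > 1"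
proof -
  obtain s where "m = Suc s" "s > 0"
    using \<open>m > 1\<close> by (cases m) auto
  then show ?thesis
    using bernoulli_poly_add_1[of s 0] bernoulli_poly_reflect[of m 0] \<open>odd m\<close>
    by (simp add: zero_power)
qed

lemma bernoulli_poly_expand:
  "bernoulli_poly m x =
    (\<Sum>i\<le>m. fact m * (bernoulli_gf 0 $ i) / fact (m - i) * x ^ (m - i))"
  unfolding bernoulli_poly_def bernoulli_gf_expand[of x]
  by (simp add: fps_mult_nth atLeast0AtMost sum_distrib_left mult_ac)

text \<open>The recursion for the Bernoulli numbers divided by factorials, used to bound their denominators:
  the factorials that occur on the right go up to \<open>(m + 1)!\<close> only.\<close>

lemma bernoulli_gf_0_rec:
  "bernoulli_gf 0 $ m = (if m = 0 then 1 else 0) - (\<Sum>i<m. bernoulli_gf 0 $ i / fact (Suc m - i))"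
proof -
  have "(bernoulli_gf 0 * (fps_exp 1 - 1)) $ Suc m = (if m = 0 then 1 else 0)"
    unfolding bernoulli_gf_mult by (auto simp: fps_X_nth)
  moreover have "(bernoulli_gf 0 * (fps_exp 1 - 1)) $ Suc m =
      (\<Sum>i<m. bernoulli_gf 0 $ i / fact (Suc m - i)) + bernoulli_gf 0 $ m"
  proof -
    have "(bernoulli_gf 0 * (fps_exp 1 - 1)) $ Suc m =
        (\<Sum>i<Suc (Suc m). bernoulli_gf 0 $ i * (fps_exp 1 - 1) $ (Suc m - i))"
      by (simp add: fps_mult_nth atLeast0AtMost lessThan_Suc_atMost)
    also have "\<dots> = (\<Sum>i<m. bernoulli_gf 0 $ i * (fps_exp 1 - 1) $ (Suc m - i)) + bernoulli_gf 0 $ m"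
      by simp
    also have "(\<Sum>i<m. bernoulli_gf 0 $ i * (fps_exp 1 - 1) $ (Suc m - i)) =
        (\<Sum>i<m. bernoulli_gf 0 $ i / fact (Suc m - i))"
      by (intro sum.cong refl) auto
    finally show ?thesis .
  qed
  ultimately show ?thesis
    by simp
qed

context prime_above_3
begin

lemma Z_divide_fact: "x / fact d \<in> Z" if "x \<in> Z" "d < p"
  using Z_divide_nat[of x "fact d"] that prime_p by (simp add: prime_dvd_fact_iff)

text \<open>Below the index \<open>p - 1\<close>, the recursion only divides by factorials of numbers less than \<open>p\<close>.
  At \<open>p - 1\<close> itself the statement would fail, by von Staudt and Clausen.\<close>

lemma Z_bernoulli_gf_0: "m \<le> p - 2 \<Longrightarrow> bernoulli_gf 0 $ m \<in> Z"
proof (induction m rule: less_induct)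
  case (less m)
  then show ?case
    by (subst bernoulli_gf_0_rec) (use p_gt_3 in \<open>auto intro!: Z_diff Z_sum Z_divide_fact\<close>)
qed

lemma Z_fact: "fact m \<in> Z"
  using Z_of_nat[of "fact m"] by simp

lemma Z_bernoulli_coeff:
  "m \<le> p - 2 \<Longrightarrow> i \<le> m \<Longrightarrow> fact m * (bernoulli_gf 0 $ i) / fact (m - i) \<in> Z"
  using p_gt_3 by (intro Z_divide_fact Z_mult Z_bernoulli_gf_0 Z_fact) auto

lemma pcong_bernoulli_poly:
  assumes "m \<le> p - 2" "x \<in> Z" "y \<in> Z" "pcong 1 x y"
  shows "pcong 1 (bernoulli_poly m x) (bernoulli_poly m y)"
  unfolding bernoulli_poly_expand
  using assms by (intro pcong_sum pcong_cmult Z_bernoulli_coeff pcong_power) auto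

lemma inverse_square_pcong_power:
  assumes "\<not> p dvd k"
  shows "pcong 1 (1 / of_nat k ^ 2) (of_nat k ^ (p - 3))"
proof -
  have "[int (k ^ (p - 1)) = int 1] (mod int p)"
    using fermat_theorem[OF prime_p assms] by (simp only: cong_int_iff)
  then have fermat: "pcong 1 (of_nat k ^ (p - 1)) 1"
    using pcong_int[of "int (k ^ (p - 1))" 1] by simp
  have k: "(of_nat k :: rat) \<noteq> 0"
    using assms by (auto intro: ccontr)
  have "p - 1 = (p - 3) + 2"
    using p_gt_3 by simp
  then have "(of_nat k :: rat) ^ (p - 1) = of_nat k ^ (p - 3) * of_nat k ^ 2"
    by (simp only: power_add)
  then have "1 / of_nat k ^ 2 * (of_nat k :: rat) ^ (p - 1) = of_nat k ^ (p - 3)"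
    using k by simp
  moreover have "1 / of_nat k ^ 2 \<in> Z"
    using Z_power[OF Z_inverse_nat[OF assms], of 2] by (simp add: power_one_over)
  ultimately show ?thesis
    using pcong_cmult[OF fermat, of "1 / of_nat k ^ 2"] by (metis mult.right_neutral pcong_sym)
qed

text \<open>Fermat's theorem replaces \<open>1 / k\<^sup>2\<close> by \<open>k\<^bsup>p - 3\<^esup>\<close>; the multiples of \<open>p\<close> may then be added, since \<open>p - 3\<close> is
  positive. Faulhaber's formula evaluates the sum, with leading factor \<open>p - 2\<close> congruent to \<open>-2\<close>.\<close>

lemma sum_inverse_squares_pcong:
  assumes "y \<in> Z" "pcong 1 (of_nat N) y"
  shows "pcong 1 (\<Sum>k | k < N \<and> \<not> p dvd k. 1 / of_nat k ^ 2) (- bernoulli_poly (p - 2) y / 2)"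
proof -
  let ?S = "\<Sum>k<N. of_nat k ^ (p - 3) :: rat"
  have odd: "odd (p - 2)"
    using prime_p p_gt_3 prime_odd_nat[of p] by simp
  have "pcong 1 (\<Sum>k | k < N \<and> \<not> p dvd k. 1 / of_nat k ^ 2)
      (\<Sum>k | k < N \<and> \<not> p dvd k. of_nat k ^ (p - 3))"
    by (intro pcong_sum inverse_square_pcong_power) auto
  also have "pcong 1 (\<Sum>k | k < N \<and> \<not> p dvd k. of_nat k ^ (p - 3)) ?S"
  proof -
    have "?S = (\<Sum>k | k < N \<and> \<not> p dvd k. of_nat k ^ (p - 3)) + (\<Sum>k | k < N \<and> p dvd k. of_nat k ^ (p - 3))"
      by (subst sum.union_disjoint [symmetric]) (auto intro!: sum.cong)
    moreover have "pcong 1 (\<Sum>k | k < N \<and> p dvd k. of_nat k ^ (p - 3)) (\<Sum>k | k < N \<and> p dvd k. 0)"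
    proof (rule pcong_sum)
      fix k
      assume "k \<in> {k. k < N \<and> p dvd k}"
      then have "p ^ 1 dvd k ^ (p - 3)"
        using p_gt_3 by (auto intro: dvd_power_same dvd_trans simp: dvd_power_iff)
      then show "pcong 1 (of_nat k ^ (p - 3)) 0"
        using pcong_of_nat_0[of 1 "k ^ (p - 3)"] by (simp only: of_nat_power)
    qed
    ultimately show ?thesis
      using pcong_add[OF pcong_refl] pcong_sym by fastforce
  qed
  also have "pcong 1 ?S (- 1 / 2 * (of_nat (p - 2) * ?S))"
  proof (rule pcongI[of "1 / 2 * ?S"])
    show "1 / 2 * ?S \<in> Z"
    proof -
      have "\<not> p dvd 2"
        using p_gt_3 by (auto dest: dvd_imp_le)
      then show ?thesis
        using Z_inverse_nat[of 2] by (intro Z_mult Z_sum) auto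
    qed
  qed (use p_gt_3 in \<open>simp add: of_nat_diff field_simps\<close>)
  also have "of_nat (p - 2) * ?S = bernoulli_poly (p - 2) (of_nat N)"
    using sum_powers_bernoulli_poly[of "p - 3" N] p_gt_3 bernoulli_poly_odd_0[OF odd]
    by (simp add: Suc_diff_Suc numeral_3_eq_3 numeral_2_eq_2)
  also have "pcong 1 (- 1 / 2 * bernoulli_poly (p - 2) (of_nat N)) (- 1 / 2 * bernoulli_poly (p - 2) y)"
  proof (intro pcong_cmult pcong_bernoulli_poly)
    have "\<not> p dvd 2"
      using p_gt_3 by (auto dest: dvd_imp_le)
    then show "- 1 / 2 \<in> Z"
      using Z_uminus[OF Z_inverse_nat[of 2]] by auto
  qed (use assms in auto)
  finally show ?thesis
    by simp
qed

end

section \<open>Binomial coefficients modulo powers of p\<close>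

lemma binomial_add_eq_prod:
  "(of_nat ((N + K) choose K) :: rat) = (\<Prod>l\<in>{1..K}. of_nat (N + l) / of_nat l)"
proof (induction K)
  case (Suc K)
  have "(of_nat (Suc K * (Suc (N + K) choose Suc K)) :: rat) = of_nat (Suc (N + K) * ((N + K) choose K))"
    by (simp only: Suc_times_binomial)
  then have "(of_nat (Suc (N + K) choose Suc K) :: rat) =
      of_nat (Suc (N + K)) * of_nat ((N + K) choose K) / of_nat (Suc K)"
    by (metis nonzero_mult_div_cancel_left of_nat_eq_0_iff of_nat_mult nat.distinct(2))
  then show ?case
    using Suc by (simp del: binomial_Suc_Suc of_nat_Suc)
qed simp

lemma mult_divide_shift:
  fixes u v x y c w :: rat
  assumes "u * v = c * w + x * y" "x \<noteq> 0" "y \<noteq> 0"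
  shows "u / x * (v / y) = 1 + c * (w * (1 / (x * y)))"
proof -
  have "u / x * (v / y) = (c * w + x * y) / (x * y)"
    by (simp flip: assms(1))
  then show ?thesis
    using assms(2,3) by (simp add: add_divide_distrib)
qed

lemma reflected_product:
  fixes l x y :: nat
  assumes "l \<le> y"
  shows "(x + l) * (x + (y - l)) = x * (x + y) + l * (y - l)"
proof -
  obtain m where "y = l + m"
    using assms le_Suc_ex by blast
  then show ?thesis
    by (simp add: algebra_simps)
qed

context prime_above_3
begin

lemma prime_dvd_choose_prime_power:
  assumes "0 < k" "k < p ^ a"
  shows "p dvd p ^ a choose k"
proof (rule ccontr)
  assume "\<not> p dvd p ^ a choose k"
  then have "coprime (p ^ a) (p ^ a choose k)"
    using prime_p by (simp add: prime_imp_coprime)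
  moreover have "p ^ a dvd k * (p ^ a choose k)"
    using times_binomial_minus1_eq[OF assms(1)] by simp
  ultimately have "p ^ a dvd k"
    by (simp add: coprime_dvd_mult_left_iff)
  then show False
    using assms by (auto dest: dvd_imp_le)
qed

lemma pcong_choose_prime_power_minus_1:
  "k < p ^ a \<Longrightarrow> pcong 1 (of_nat (p ^ a - 1 choose k)) ((-1) ^ k)"
proof (induction k)
  case (Suc k)
  have "p ^ a choose Suc k = (p ^ a - 1 choose k) + (p ^ a - 1 choose Suc k)"
    using Suc.prems prime_gt_0_nat[OF prime_p] by (subst choose_reduce_nat) auto
  then have "(of_nat (p ^ a - 1 choose Suc k) :: rat) =
      of_nat (p ^ a choose Suc k) + (-1) * of_nat (p ^ a - 1 choose k)"
    by simp
  also have "pcong 1 \<dots> (0 + (-1) * (-1) ^ k)"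
    using Suc prime_dvd_choose_prime_power[of "Suc k" a]
    by (intro pcong_add pcong_cmult pcong_of_nat_0 Z_uminus) simp_all
  finally show ?case
    by simp
qed simp

text \<open>In the Vandermonde expansion only the term for \<open>j = 0\<close> is not divisible by \<open>p\<close>.\<close>

lemma pcong_choose_prime_power_add:
  assumes "s < p ^ a"
  shows "pcong 1 (of_nat (p ^ a + s choose s)) 1"
proof -
  have "(of_nat (p ^ a + s choose s) :: rat) = (\<Sum>j\<le>s. of_nat (p ^ a choose j) * of_nat (s choose (s - j)))"
    by (simp flip: vandermonde)
  also have "pcong 1 \<dots> (\<Sum>j\<le>s. if j = 0 then 1 else 0)"
  proof (rule pcong_sum)
    fix j
    assume "j \<in> {..s}"
    then have "p ^ 1 dvd (p ^ a choose j) * (s choose (s - j))" if "j > 0"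
      using that assms prime_dvd_choose_prime_power[of j a] by simp
    then show "pcong 1 (of_nat (p ^ a choose j) * of_nat (s choose (s - j))) (if j = 0 then 1 else 0)"
      using pcong_of_nat_0[of 1 "(p ^ a choose j) * (s choose (s - j))"] by auto
  qed
  finally show ?thesis
    by simp
qed

text \<open>All products of two or more of the summands \<open>p\<^sup>e y\<close> vanish modulo \<open>p\<^bsup>2e\<^esup>\<close>, hence modulo
  \<open>p\<^bsup>e + 1\<^esup>\<close>.\<close>

lemma prod_one_plus_pcong:
  assumes "finite A" "\<And>l. l \<in> A \<Longrightarrow> y l \<in> Z" "e > 0"
  shows "pcong (Suc e) (\<Prod>l\<in>A. 1 + of_nat p ^ e * y l) (1 + of_nat p ^ e * (\<Sum>l\<in>A. y l))"
  using assms(1,2)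
proof (induction A rule: finite_induct)
  case (insert x A)
  let ?c = "of_nat p ^ e :: rat"
  have yx: "y x \<in> Z" and S: "(\<Sum>l\<in>A. y l) \<in> Z"
    using insert by auto
  have "pcong (Suc e) (\<Prod>l\<in>insert x A. 1 + ?c * y l) ((1 + ?c * y x) * (1 + ?c * (\<Sum>l\<in>A. y l)))"
    using insert yx by (simp, intro pcong_cmult Z_add Z_mult) auto
  also have "pcong (Suc e) \<dots> (1 + ?c * (\<Sum>l\<in>insert x A. y l))"
  proof (rule pcongI)
    show "of_nat p ^ (e - 1) * y x * (\<Sum>l\<in>A. y l) \<in> Z"
      using yx S by auto
    have "(of_nat p :: rat) ^ e * of_nat p ^ e = of_nat p ^ Suc e * of_nat p ^ (e - 1)"
      using assms(3) by (cases e) (simp_all add: mult_ac)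
    then show "(1 + ?c * y x) * (1 + ?c * (\<Sum>l\<in>A. y l)) - (1 + ?c * (\<Sum>l\<in>insert x A. y l)) =
      of_nat p ^ Suc e * (of_nat p ^ (e - 1) * y x * (\<Sum>l\<in>A. y l))"
      using insert by (simp add: algebra_simps)
  qed
  finally show ?case .
qed simp

lemma not_p_dvd_2: "\<not> p dvd 2" and not_p_dvd_3: "\<not> p dvd 3"
  using p_gt_3 by (auto dest: dvd_imp_le)

text \<open>The quotient of \<open>binom(p (j + k), p k)\<close> by \<open>binom(j + k, k)\<close>: in the product of all
  \<open>(p j + l) / l\<close> with \<open>0 < l \<le> p k\<close>, the multiples \<open>l\<close> of \<open>p\<close> contribute the smaller binomial
  coefficient, and the remaining factors, which are units, are collected here.\<close>

definition block_ratio :: "nat \<Rightarrow> nat \<Rightarrow> rat" where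
  "block_ratio j k = (\<Prod>l | l < p * k \<and> \<not> p dvd l. of_nat (p * j + l) / of_nat l)"

lemma Z_block_ratio: "block_ratio j k \<in> Z"
  unfolding block_ratio_def by (auto intro!: Z_prod Z_divide_nat)

lemma binomial_mult_p: "of_nat (p * (j + k) choose (p * k)) = of_nat (j + k choose k) * block_ratio j k"
proof -
  let ?f = "\<lambda>l. of_nat (p * j + l) / of_nat l :: rat"
  have p0: "p > 0"
    using p_gt_3 by simp
  have split: "{1..p * k} = (\<lambda>l. p * l) ` {1..k} \<union> {l. l < p * k \<and> \<not> p dvd l}"
  proof (intro equalityI subsetI)
    fix x
    assume x: "x \<in> {1..p * k}"
    show "x \<in> (\<lambda>l. p * l) ` {1..k} \<union> {l. l < p * k \<and> \<not> p dvd l}"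
    proof (cases "p dvd x")
      case True
      then obtain q where q: "x = p * q"
        by (rule dvdE)
      then have "p * q \<le> p * k" "q \<noteq> 0"
        using x by auto
      then have "q \<in> {1..k}"
        using p0 by (simp add: mult_le_cancel1)
      then show ?thesis
        using q by blast
    next
      case False
      then have "x \<noteq> p * k"
        by auto
      then show ?thesis
        using x False by simp
    qed
  next
    fix x
    assume "x \<in> (\<lambda>l. p * l) ` {1..k} \<union> {l. l < p * k \<and> \<not> p dvd l}"
    then show "x \<in> {1..p * k}"
      using p0 by (cases "x = 0") auto
  qed
  have "of_nat (p * (j + k) choose (p * k)) = prod ?f {1..p * k}"
    using binomial_add_eq_prod[of "p * j" "p * k"] by (simp add: distrib_left)
  also have "\<dots> = prod ?f ((\<lambda>l. p * l) ` {1..k}) * block_ratio j k"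
    unfolding split block_ratio_def by (rule prod.union_disjoint) auto
  also have "prod ?f ((\<lambda>l. p * l) ` {1..k}) = (\<Prod>l\<in>{1..k}. of_nat (j + l) / of_nat l)"
    using p0 by (subst prod.reindex) (auto simp: inj_on_def simp flip: distrib_left intro!: prod.cong)
  also have "\<dots> = of_nat (j + k choose k)"
    by (rule binomial_add_eq_prod [symmetric])
  finally show ?thesis .
qed

text \<open>Modulo \<open>p\<close> the summand is \<open>- 1 / l\<^sup>2\<close>, and the sum of the inverse squares over full periods vanishes
  because it is governed by \<open>B\<^bsub>p - 2\<^esub>(0) = 0\<close>.\<close>

lemma sum_reflected_inverse_products_pcong:
  "pcong 1 (\<Sum>l | l < p * k \<and> \<not> p dvd l. 1 / (of_nat l * of_nat (p * k - l))) 0"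
proof -
  let ?L = "{l. l < p * k \<and> \<not> p dvd l}"
  have "pcong 1 (\<Sum>l\<in>?L. 1 / (of_nat l * of_nat (p * k - l))) (\<Sum>l\<in>?L. (-1) * (1 / of_nat l ^ 2))"
  proof (rule pcong_sum)
    fix l
    assume l: "l \<in> ?L"
    then have l0: "\<not> p dvd l ^ 2 * (p * k - l)"
      using prime_p by (auto simp: prime_dvd_mult_iff prime_dvd_power_iff dvd_diff_nat dest: dvd_diffD1)
    show "pcong 1 (1 / (of_nat l * of_nat (p * k - l))) ((-1) * (1 / of_nat l ^ 2))"
    proof (rule pcongI)
      show "of_nat k / of_nat (l ^ 2 * (p * k - l)) \<in> Z"
        using l0 by (intro Z_divide_nat) auto
      have "(of_nat l :: rat) \<noteq> 0" "(of_nat (p * k) - of_nat l :: rat) \<noteq> 0"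
        using l by (auto simp flip: of_nat_mult intro: ccontr)
      then show "1 / (of_nat l * of_nat (p * k - l)) - (-1) * (1 / of_nat l ^ 2) =
          (of_nat p ^ 1 * (of_nat k / of_nat (l ^ 2 * (p * k - l))) :: rat)"
        using l by (simp add: of_nat_diff field_simps power2_eq_square)
    qed
  qed
  also have "(\<Sum>l\<in>?L. (-1) * (1 / of_nat l ^ 2)) = (-1) * (\<Sum>l\<in>?L. 1 / of_nat l ^ 2 :: rat)"
    by (rule sum_distrib_left [symmetric])
  also have "pcong 1 \<dots> ((-1) * (- bernoulli_poly (p - 2) 0 / 2))"
    by (intro pcong_cmult sum_inverse_squares_pcong pcong_of_nat_0 Z_uminus) auto
  also have "bernoulli_poly (p - 2) 0 = 0"
    using prime_p p_gt_3 prime_odd_nat[of p] by (intro bernoulli_poly_odd_0) auto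
  finally show ?thesis
    by simp
qed

text \<open>The set of indices \<open>l\<close> is invariant under \<open>l \<mapsto> p k - l\<close>. Pairing reflected factors writes the square of
  the ratio as the product of all \<open>1 + X / (l (p k - l))\<close> with \<open>X = p\<^sup>2 j (j + k)\<close>, which is
  divisible by \<open>p\<^bsup>2 + 2v\<^esup>\<close>. One more power of \<open>p\<close> comes from the vanishing of the sum of all
  \<open>1 / (l (p k - l))\<close>. Since the ratio itself is 1 modulo \<open>p\<close>, its sum with 1 is a unit, and the
  congruence for the square descends to the ratio.\<close>

lemma block_ratio_pcong:
  assumes "p ^ v dvd j" "p ^ v dvd k"
  shows "pcong (3 + 2 * v) (block_ratio j k) 1"
proof -
  let ?L = "{l. l < p * k \<and> \<not> p dvd l}"
  let ?F = "block_ratio j k"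
  obtain j' k' where j': "j = p ^ v * j'" and k': "k = p ^ v * k'"
    using assms by (auto elim!: dvdE)
  define e where "e = 2 + 2 * v"
  define w where "w = j' * (j' + k')"
  have w: "p * j * (p * j + p * k) = p ^ e * w"
    unfolding e_def w_def j' k' by (simp add: algebra_simps power_add power2_eq_square mult_2 mult_2_right)
  have reflect_less: "p * k - l < p * k" if "l < p * k" "\<not> p dvd l" for l
    using that by (cases l) auto
  have bij: "bij_betw (\<lambda>l. p * k - l) ?L ?L"
    by (rule bij_betw_byWitness[where f' = "\<lambda>l. p * k - l"])
       (use reflect_less in \<open>auto dest: dvd_diffD1\<close>)
  have unit: "\<not> p dvd l" "\<not> p dvd p * k - l" "l < p * k" if "l \<in> ?L" for l
    using that by (auto dest: dvd_diffD1)
  have yZ: "of_nat w * (1 / (of_nat l * of_nat (p * k - l))) \<in> Z" if "l \<in> ?L" for l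
  proof -
    have "\<not> p dvd l * (p * k - l)"
      using unit(1,2)[OF that] prime_p by (metis prime_dvd_mult_iff)
    then have "1 / (of_nat (l * (p * k - l))) \<in> Z"
      by (rule Z_inverse_nat)
    then show ?thesis
      by (intro Z_mult Z_of_nat) (simp only: of_nat_mult)
  qed
  have "?F ^ 2 = (\<Prod>l\<in>?L. of_nat (p * j + l) / of_nat l) * (\<Prod>l\<in>?L. of_nat (p * j + (p * k - l)) / of_nat (p * k - l))"
    unfolding block_ratio_def power2_eq_square
    by (subst prod.reindex_bij_betw [OF bij, symmetric]) (rule refl)
  also have "\<dots> = (\<Prod>l\<in>?L. 1 + of_nat p ^ e * (of_nat w * (1 / (of_nat l * of_nat (p * k - l)))))"
    unfolding prod.distrib [symmetric]
  proof (intro prod.cong refl)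
    fix l
    assume l: "l \<in> ?L"
    have nz: "(of_nat l :: rat) \<noteq> 0" "(of_nat (p * k - l) :: rat) \<noteq> 0"
      using unit(1,2)[OF l] by (metis dvd_0_right of_nat_eq_0_iff)+
    have "(p * j + l) * (p * j + (p * k - l)) = p ^ e * w + l * (p * k - l)"
      using reflected_product[of l "p * k" "p * j"] unit(3)[OF l] w by simp
    then have "(of_nat (p * j + l) * of_nat (p * j + (p * k - l)) :: rat) =
        of_nat p ^ e * of_nat w + of_nat l * of_nat (p * k - l)"
      by (metis of_nat_add of_nat_mult of_nat_power)
    then show "of_nat (p * j + l) / of_nat l * (of_nat (p * j + (p * k - l)) / of_nat (p * k - l)) =
      (1 + of_nat p ^ e * (of_nat w * (1 / (of_nat l * of_nat (p * k - l)))) :: rat)"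
      using nz by (rule mult_divide_shift)
  qed
  also have "pcong (Suc e) \<dots> (1 + of_nat p ^ e * (\<Sum>l\<in>?L. of_nat w * (1 / (of_nat l * of_nat (p * k - l)))))"
    using yZ by (intro prod_one_plus_pcong) (auto simp: e_def)
  also have "pcong (Suc e) \<dots> 1"
  proof -
    obtain z where z: "z \<in> Z"
      "(\<Sum>l\<in>?L. 1 / (of_nat l * of_nat (p * k - l))) = of_nat p ^ 1 * z"
      using sum_reflected_inverse_products_pcong[of k] unfolding pcong_0_iff by blast
    show ?thesis
      by (rule pcongI[of "of_nat w * z"]) (use z(1) in simp, simp only: sum_distrib_left [symmetric] z(2), simp)
  qed
  finally have sq: "pcong (Suc e) (?F ^ 2) 1" .
  have F1: "pcong 1 ?F 1"
  proof -
    have "pcong 1 ?F (\<Prod>l\<in>?L. 1)"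
      unfolding block_ratio_def
    proof (rule pcong_prod)
      fix l
      assume l: "l \<in> ?L"
      then have "(of_nat l :: rat) \<noteq> 0"
        using unit(1) by (metis dvd_0_right of_nat_eq_0_iff)
      then have "of_nat (p * j + l) / of_nat l - 1 = (of_nat p ^ 1 * (of_nat j / of_nat l) :: rat)"
        by (simp add: add_divide_distrib)
      then show "pcong 1 (of_nat (p * j + l) / of_nat l) 1"
        by (rule pcongI [rotated]) (rule Z_divide_nat[OF Z_of_nat unit(1)[OF l]])
      show "of_nat (p * j + l) / of_nat l \<in> Z"
        using unit(1)[OF l] by (intro Z_divide_nat Z_of_nat)
    qed (rule Z_1)
    then show ?thesis
      by simp
  qed
  obtain z where z: "z \<in> Z" "?F ^ 2 - 1 = of_nat p ^ Suc e * z"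
    using sq unfolding pcong_def by blast
  obtain y where y: "y \<in> Z" "?F + 1 = 2 + of_nat p * y"
    using F1 unfolding pcong_def by (auto simp: algebra_simps)
  \<comment> \<open>The ratio plus 1 is a unit, being 2 modulo the odd prime \<open>p\<close>.\<close>
  have inv: "1 / (2 + of_nat p * y) \<in> Z" "2 + of_nat p * y \<noteq> 0"
  proof -
    obtain c d where cd: "\<not> int p dvd d" "y = of_int c / of_int d"
      using y(1) unfolding Z_iff by blast
    then have "d \<noteq> 0"
      by auto
    then have eq: "2 + of_nat p * y = of_int (2 * d + int p * c) / of_int d"
      using cd by (simp add: field_simps)
    have "\<not> int p dvd 2"
      using not_p_dvd_2 by (metis int_dvd_int_iff of_nat_numeral)
    then have "\<not> int p dvd 2 * d"
      using cd(1) prime_int_p by (simp add: prime_dvd_mult_iff)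
    then have nd: "\<not> int p dvd 2 * d + int p * c"
      by (simp add: dvd_add_left_iff)
    then have "2 * d + int p * c \<noteq> 0"
      by (metis dvd_0_right)
    then show "2 + of_nat p * y \<noteq> 0"
      unfolding eq using \<open>d \<noteq> 0\<close> by (metis divide_eq_0_iff of_int_eq_0_iff)
    have "1 / (2 + of_nat p * y) = of_int d * (1 / of_int (2 * d + int p * c))"
      unfolding eq by simp
    then show "1 / (2 + of_nat p * y) \<in> Z"
      using Z_mult[OF Z_of_int Z_inverse_int[OF nd]] by simp
  qed
  have "(?F - 1) * (2 + of_nat p * y) = of_nat p ^ Suc e * z"
    using z(2) unfolding y(2) [symmetric] by (simp add: algebra_simps power2_eq_square)
  then have "?F - 1 = of_nat p ^ Suc e * (z * (1 / (2 + of_nat p * y)))"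
    using inv(2) by (simp add: field_simps)
  then have "pcong (Suc e) ?F 1"
    by (rule pcongI [rotated]) (rule Z_mult[OF z(1) inv(1)])
  moreover have "Suc e = 3 + 2 * v"
    by (simp add: e_def)
  ultimately show ?thesis
    by (simp only:)
qed

end

section \<open>The terms of the alternating sum\<close>

text \<open>The absorption identity extracts a factor \<open>n\<close> from each binomial coefficient: the first is
  \<open>n / k\<close> times an integer, the second, read as \<open>binom(n + i - 1, i)\<close> with \<open>i = n - 3k\<close>, is \<open>n / i\<close>
  times an integer.\<close>

lemma trinomial_term_absorb:
  assumes "0 < k" "3 * k < n"
  shows "int (k * (n - 3 * k)) * trinomial_term n k =
    (-1) ^ k * int (n ^ 2 * ((n - 1 choose (k - 1)) * (n + (n - 3 * k - 1) choose (n - 3 * k - 1))))"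
proof -
  define s where "s = n - 3 * k - 1"
  have s: "n - 3 * k = Suc s" "2 * n - 3 * k - 1 = n + s"
    using assms by (auto simp: s_def)
  obtain b where b: "n = Suc b"
    using assms by (cases n) auto
  have "n + s choose (n - 1) = n + s choose Suc s"
    using binomial_symmetric[of "Suc s" "n + s"] by (simp add: b)
  then have "Suc s * (n + s choose (n - 1)) = n * (n + s choose s)"
    using Suc_times_binomial_add[of s b] by (simp add: b add.commute)
  moreover have "k * (n choose k) = n * (n - 1 choose (k - 1))"
    using times_binomial_minus1_eq[OF assms(1)] .
  ultimately have "k * (n choose k) * (Suc s * (n + s choose (n - 1))) =
      n * (n - 1 choose (k - 1)) * (n * (n + s choose s))"
    by (simp only:)
  then have "int (k * Suc s) * (int (n choose k) * int (n + s choose (n - 1))) =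
      int (n ^ 2 * ((n - 1 choose (k - 1)) * (n + s choose s)))"
    unfolding of_nat_mult [symmetric] of_nat_eq_iff power2_eq_square by (simp only: ac_simps)
  then have "(-1) ^ k * (int (k * Suc s) * (int (n choose k) * int (n + s choose (n - 1)))) =
      (-1) ^ k * int (n ^ 2 * ((n - 1 choose (k - 1)) * (n + s choose s)))"
    by (simp only:)
  then show ?thesis
    unfolding trinomial_term_def s diff_Suc_1 by (simp only: ac_simps)
qed

context prime_above_3
begin

lemma odd_p: "odd p"
  using prime_p p_gt_3 prime_odd_nat[of p] by simp

text \<open>The boundary index \<open>3 k = n\<close> does not occur, so the denominators \<open>n - 3 k\<close> below are nonzero.\<close>

lemma three_mult_neq_prime_power: "3 * k \<noteq> p ^ c"
proof
  assume "3 * k = p ^ c"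
  then have "3 dvd p ^ c"
    by (metis dvd_triv_left)
  then have "3 dvd p"
    using prime_dvd_power[of 3 p c] by simp
  then show False
    using prime_p p_gt_3 primes_dvd_imp_eq[of 3 p] by simp
qed

text \<open>The two binomial coefficients left by absorption are \<open>(-1)\<^bsup>k - 1\<^esup>\<close> and \<open>1\<close> modulo \<open>p\<close>, and the
  denominator \<open>k (n - 3k)\<close> is \<open>- 3 k\<^sup>2\<close>.\<close>

lemma trinomial_term_coprime:
  assumes "\<not> p dvd k" "3 * k < p ^ a"
  shows "pcong 1 (of_int (trinomial_term (p ^ a) k) / of_nat (p ^ a) ^ 2) (1 / 3 * (1 / of_nat k ^ 2))"
proof -
  define n where "n = p ^ a"
  define s where "s = n - 3 * k - 1"
  have k: "0 < k" "3 * k < n"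
    using assms by (auto simp: n_def intro: gr0I)
  have a: "p dvd n"
    using assms k by (cases a) (auto simp: n_def)
  have i: "\<not> p dvd n - 3 * k"
  proof
    assume "p dvd n - 3 * k"
    then have "p dvd 3 * k"
      using a k by (metis dvd_diffD1 less_imp_le)
    then show False
      using assms not_p_dvd_3 prime_p by (metis prime_dvd_mult_iff)
  qed
  then have ki: "\<not> p dvd k * (n - 3 * k)"
    using assms prime_p by (metis prime_dvd_mult_iff)
  let ?d = "of_nat (k * (n - 3 * k)) :: rat"
  let ?A = "of_nat (n - 1 choose (k - 1)) :: rat" and ?B = "of_nat (n + s choose s) :: rat"
  have n0: "(of_nat n :: rat) \<noteq> 0" and d0: "?d \<noteq> 0" and k0: "(of_nat k :: rat) \<noteq> 0"
    using k by simp_all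
  have "of_int (int (k * (n - 3 * k)) * trinomial_term n k) =
      (of_int ((-1) ^ k * int (n ^ 2 * ((n - 1 choose (k - 1)) * (n + s choose s)))) :: rat)"
    using trinomial_term_absorb[OF k] by (simp only: s_def)
  then have "?d * of_int (trinomial_term n k) = (-1) ^ k * (of_nat n ^ 2 * (?A * ?B))"
    by (simp only: of_int_mult of_int_of_nat_eq of_int_power of_int_minus of_int_1 of_nat_mult of_nat_power)
  then have "of_int (trinomial_term n k) / of_nat n ^ 2 = (-1) ^ k * (1 / ?d) * (?A * ?B)"
    using n0 d0 by (simp add: divide_simps mult_ac del: of_nat_mult)
  also have "pcong 1 \<dots> ((-1) ^ k * (1 / ?d) * ((-1) ^ (k - 1) * 1))"
    using k pcong_choose_prime_power_minus_1[of "k - 1" a] pcong_choose_prime_power_add[of s a]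
    by (intro pcong_cmult pcong_mult Z_mult Z_power Z_uminus Z_inverse_nat ki Z_1 Z_of_nat)
       (simp_all add: n_def s_def)
  also have "(-1) ^ k * (1 / ?d) * ((-1) ^ (k - 1) * 1) = - (1 / ?d)"
    using k(1) by (cases k) (simp_all flip: power_mult_distrib)
  also have "pcong 1 (- (1 / ?d)) (1 / 3 * (1 / of_nat k ^ 2))"
  proof -
    obtain h where h: "n = p * h"
      using a by (rule dvdE)
    have nd: "\<not> p dvd 3 * k * (k * (n - 3 * k))"
      using ki assms not_p_dvd_3 prime_p by (metis prime_dvd_mult_iff)
    have sub: "(of_nat (n - 3 * k) :: rat) = of_nat n - 3 * of_nat k"
      using k by (simp add: of_nat_diff)
    have nz: "(of_nat n - 3 * of_nat k :: rat) \<noteq> 0"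
      using d0 unfolding of_nat_mult sub by auto
    have "- (1 / ?d) - 1 / 3 * (1 / of_nat k ^ 2) = - of_nat n / of_nat (3 * k * (k * (n - 3 * k)))"
      unfolding of_nat_mult sub using k0 nz by (simp add: divide_simps power2_eq_square)
    also have "\<dots> = of_nat p ^ 1 * (- (of_nat h / of_nat (3 * k * (k * (n - 3 * k)))))"
      by (subst h) (simp del: of_nat_mult add: of_nat_mult[of p h])
    finally show ?thesis
      by (rule pcongI [rotated]) (rule Z_uminus[OF Z_divide_nat[OF Z_of_nat nd]])
  qed
  finally show ?thesis
    unfolding n_def .
qed

lemma binomial_minus_1_mult_p:
  assumes "0 < m"
  shows "(of_nat (p * (j + m) - 1 choose (p * m - 1)) :: rat) =
    of_nat (j + m - 1 choose (m - 1)) * block_ratio j m"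
proof -
  have pm: "0 < p * m" "p > 0"
    using assms p_gt_3 by simp_all
  have "of_nat (p * m * (p * (j + m) choose (p * m))) =
      (of_nat (p * (j + m) * (p * (j + m) - 1 choose (p * m - 1))) :: rat)"
    by (subst times_binomial_minus1_eq[OF pm(1)]) (rule refl)
  then have 1: "of_nat m * of_nat (p * (j + m) choose (p * m)) =
      (of_nat (j + m) * of_nat (p * (j + m) - 1 choose (p * m - 1)) :: rat)"
    using pm(2) unfolding of_nat_mult by (simp del: of_nat_add)
  have 2: "of_nat m * of_nat (j + m choose m) = (of_nat (j + m) * of_nat (j + m - 1 choose (m - 1)) :: rat)"
    using times_binomial_minus1_eq[OF assms, of "j + m"] by (metis of_nat_mult)
  have "of_nat (j + m) * of_nat (p * (j + m) - 1 choose (p * m - 1)) =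
      of_nat (j + m) * (of_nat (j + m - 1 choose (m - 1)) * block_ratio j m)"
    using 1 2 unfolding binomial_mult_p by (metis mult.assoc)
  moreover have "(of_nat (j + m) :: rat) \<noteq> 0"
    using assms by simp
  ultimately show ?thesis
    by (metis mult_left_cancel)
qed

lemma trinomial_term_mult_p:
  assumes "3 * q < m"
  shows "of_int (trinomial_term (p * m) (p * q)) =
    of_int (trinomial_term m q) * (block_ratio (m - q) q * block_ratio (m - 3 * q) m)"
proof -
  have m: "0 < m" "m - q + q = m" "m - 3 * q + m = 2 * m - 3 * q"
    using assms by auto
  have sign: "(-1) ^ (p * q) = ((-1) ^ q :: rat)"
    using odd_p by (simp add: power_mult)
  have eq: "2 * (p * m) - 3 * (p * q) = p * (m - 3 * q + m)"
    unfolding m by (simp add: diff_mult_distrib2)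
  have c1: "(of_nat (p * m choose (p * q)) :: rat) = of_nat (m choose q) * block_ratio (m - q) q"
    using binomial_mult_p[of "m - q" q] unfolding m by simp
  have c2: "(of_nat (2 * (p * m) - 3 * (p * q) - 1 choose (p * m - 1)) :: rat) =
      of_nat (2 * m - 3 * q - 1 choose (m - 1)) * block_ratio (m - 3 * q) m"
    unfolding eq using binomial_minus_1_mult_p[OF m(1), of "m - 3 * q"] unfolding m .
  have expand: "of_int (trinomial_term n k) =
      ((-1) ^ k * of_nat (n choose k) * of_nat (2 * n - 3 * k - 1 choose (n - 1)) :: rat)" for n k
    unfolding trinomial_term_def
    by (simp only: of_int_mult of_int_of_nat_eq of_int_power of_int_minus of_int_1)
  show ?thesis
    unfolding expand sign c1 c2 by (simp only: ac_simps)
qed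

text \<open>Let \<open>p\<^sup>v\<close> be the exact power of \<open>p\<close> in \<open>q > 0\<close>. As \<open>q < p\<^sup>b\<close>, we have \<open>v < b\<close>, so \<open>p\<^bsup>b\<^esup> - 3q\<close> contains the
  same power, and absorption leaves the smaller term divisible by \<open>p\<^bsup>2b - 2v\<^esup>\<close>. The two terms differ
  by a factor that is 1 modulo \<open>p\<^bsup>3 + 2v\<^esup>\<close>, so the loss of \<open>2v\<close> is compensated exactly. For
  \<open>q = 0\<close> the same count works with \<open>v = b\<close>.\<close>

lemma trinomial_term_mult_p_pcong:
  assumes "3 * q < p ^ b"
  shows "pcong (2 * b + 3) (of_int (trinomial_term (p * p ^ b) (p * q))) (of_int (trinomial_term (p ^ b) q))"
proof -
  define m where "m = p ^ b"
  define t where "t = (of_int (trinomial_term m q) :: rat)"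
  define F where "F = block_ratio (m - q) q * block_ratio (m - 3 * q) m"
  have qm: "3 * q < m"
    using assms by (simp add: m_def)
  have F: "pcong (3 + 2 * v) F 1" if "p ^ v dvd m" "p ^ v dvd q" for v
  proof -
    have "pcong (3 + 2 * v) F (1 * 1)"
      unfolding F_def using that by (intro pcong_mult block_ratio_pcong Z_block_ratio Z_1) auto
    then show ?thesis
      by simp
  qed
  obtain v z where v: "v \<le> b" "pcong (3 + 2 * v) F 1" and z: "z \<in> Z" "t = of_nat p ^ (2 * (b - v)) * z"
  proof (cases "q = 0")
    case True
    then show ?thesis
      using that[of b t] F[of b] by (simp add: m_def t_def)
  next
    case False
    define v where "v = multiplicity p q"
    obtain u where u: "q = p ^ v * u" "\<not> p dvd u"
      using multiplicity_decompose'[of q p] False prime_p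
      by (metis not_prime_unit v_def)
    have "p ^ v \<le> q"
      using u False by (cases u) auto
    then have "p ^ v < p ^ b"
      using qm by (simp add: m_def)
    then have vb: "v < b"
      using p_gt_3 by (simp add: power_strict_increasing_iff)
    then obtain c where c: "b = Suc (v + c)"
      using less_imp_Suc_add by blast
    have m: "m = p ^ v * (p * p ^ c)"
      unfolding m_def c by (simp add: power_add mult_ac)
    define w where "w = u * (p * p ^ c - 3 * u)"
    have u3: "3 * u < p * p ^ c"
    proof -
      have "p ^ v * (3 * u) < p ^ v * (p * p ^ c)"
        using qm unfolding m u(1) by (simp only: ac_simps)
      then show ?thesis
        by simp
    qed
    have w: "\<not> p dvd w"
    proof
      assume "p dvd w"
      then have "p dvd p * p ^ c - 3 * u"
        using u(2) prime_p unfolding w_def by (metis prime_dvd_mult_iff)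
      then have "p dvd 3 * u"
        using u3 by (metis dvd_diffD1 dvd_triv_left less_imp_le)
      then show False
        using u(2) not_p_dvd_3 prime_p by (metis prime_dvd_mult_iff)
    qed
    have "m - 3 * q = p ^ v * (p * p ^ c - 3 * u)"
      unfolding m u(1) by (simp add: diff_mult_distrib2 mult_ac)
    then have qw: "q * (m - 3 * q) = p ^ (2 * v) * w"
      unfolding w_def by (subst u(1)) (simp add: mult_2_right power_add mult_ac)
    obtain I where I: "int (q * (m - 3 * q)) * trinomial_term m q = int (m ^ 2) * I"
    proof
      show "int (q * (m - 3 * q)) * trinomial_term m q = int (m ^ 2) *
        ((-1) ^ q * int ((m - 1 choose (q - 1)) * (m + (m - 3 * q - 1) choose (m - 3 * q - 1))))"
        using False by (subst trinomial_term_absorb) (use qm in \<open>simp_all only: of_nat_mult ac_simps neq0_conv\<close>)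
    qed
    have m2: "m ^ 2 = p ^ (2 * v) * p ^ (2 * (b - v))"
    proof -
      have "2 * v + 2 * (b - v) = b * 2"
        using vb by simp
      then show ?thesis
        unfolding m_def power_add [symmetric] by (simp add: power_mult)
    qed
    have "int (p ^ (2 * v)) * (int w * trinomial_term m q) = int (p ^ (2 * v)) * (int (p ^ (2 * (b - v))) * I)"
      using I unfolding qw m2 of_nat_mult by (simp only: mult.assoc)
    then have "int w * trinomial_term m q = int (p ^ (2 * (b - v))) * I"
      using p_gt_3 by simp
    then have "of_int (int w * trinomial_term m q) = (of_int (int (p ^ (2 * (b - v))) * I) :: rat)"
      by (simp only:)
    then have "of_nat w * t = of_nat p ^ (2 * (b - v)) * of_int I"
      by (simp add: t_def)
    moreover have "(of_nat w :: rat) \<noteq> 0"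
      using w by (metis dvd_0_right of_nat_eq_0_iff)
    ultimately have "t = of_nat p ^ (2 * (b - v)) * (of_int I / of_nat w)"
      by (simp add: field_simps)
    moreover have "of_int I / of_nat w \<in> Z"
      using w by (intro Z_divide_nat Z_of_int)
    moreover have "pcong (3 + 2 * v) F 1"
      using F[of v] u(1) m by simp
    ultimately show ?thesis
      using that[OF less_imp_le[OF vb]] by blast
  qed
  obtain y where y: "y \<in> Z" "F - 1 = of_nat p ^ (3 + 2 * v) * y"
    using v(2) unfolding pcong_def by blast
  have e: "2 * (b - v) + (3 + 2 * v) = 2 * b + 3"
    using v(1) by simp
  have "of_int (trinomial_term (p * m) (p * q)) - t = t * (F - 1)"
    unfolding trinomial_term_mult_p[OF qm] t_def F_def by (simp add: algebra_simps)
  also have "\<dots> = of_nat p ^ (2 * (b - v) + (3 + 2 * v)) * (z * y)"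
    unfolding y(2) power_add by (subst z(2)) (simp only: ac_simps)
  finally show ?thesis
    unfolding e m_def [symmetric] t_def by (rule pcongI [rotated]) (rule Z_mult[OF z(1) y(1)])
qed

section \<open>The congruence\<close>

text \<open>Both sides are the nontrivial character modulo 3 at \<open>p\<^sup>a\<close>.\<close>

lemma Legendre_3_power:
  "Legendre (int p) 3 ^ a = (if p ^ a mod 3 = 1 then 1 else -1)" "p ^ a mod 3 = 1 \<or> p ^ a mod 3 = 2"
proof -
  have p3: "p mod 3 = 1 \<or> p mod 3 = 2"
    using three_mult_neq_prime_power[of "p div 3" 1] by (simp; presburger)
  have sq: "y ^ 2 mod 3 = (0 :: int) \<or> y ^ 2 mod 3 = 1" for y :: int
  proof -
    have "y mod 3 = 0 \<or> y mod 3 = 1 \<or> y mod 3 = 2"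
      by presburger
    moreover have "y ^ 2 mod 3 = (y mod 3) ^ 2 mod 3"
      by (simp add: power_mod)
    ultimately show ?thesis
      by auto
  qed
  have Leg: "Legendre (int p) 3 = (if p mod 3 = 1 then 1 else -1)"
  proof (cases "p mod 3 = 1")
    case True
    then have "int p mod 3 = 1"
      by presburger
    then have "QuadRes 3 (int p)" "\<not> [int p = 0] (mod 3)"
      unfolding QuadRes_def cong_def by (auto intro: exI[of _ 1])
    then show ?thesis
      using True by (simp add: Legendre_def)
  next
    case False
    then have "int p mod 3 = 2"
      using p3 by presburger
    moreover have "\<not> QuadRes 3 (int p)"
    proof
      assume "QuadRes 3 (int p)"
      then obtain y where "y ^ 2 mod 3 = int p mod 3"
        unfolding QuadRes_def cong_def by blast
      then show False
        using sq[of y] \<open>int p mod 3 = 2\<close> by simp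
    qed
    ultimately have "\<not> QuadRes 3 (int p)" "\<not> [int p = 0] (mod 3)"
      by (simp_all add: cong_def)
    then show ?thesis
      using False by (simp add: Legendre_def)
  qed
  have "Legendre (int p) 3 ^ a = (if p ^ a mod 3 = 1 then 1 else -1) \<and> (p ^ a mod 3 = 1 \<or> p ^ a mod 3 = 2)"
  proof (induction a)
    case (Suc a)
    have "p ^ Suc a mod 3 = (p mod 3) * (p ^ a mod 3) mod 3"
      by (simp add: mod_mult_eq)
    then show ?case
      using Suc Leg p3 by auto
  qed simp
  then show "Legendre (int p) 3 ^ a = (if p ^ a mod 3 = 1 then 1 else -1)" "p ^ a mod 3 = 1 \<or> p ^ a mod 3 = 2"
    by blast+
qed

text \<open>With \<open>r\<close> the residue of \<open>n = p\<^sup>a\<close> modulo 3, the number of integers from 0 to \<open>n/3\<close> is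
  \<open>(n - r)/3 + 1\<close>, hence congruent to \<open>1 - r/3\<close> modulo \<open>p\<close>. Reflection relates the case
  \<open>r = 1\<close> to \<open>B\<^bsub>p - 2\<^esub>(1/3)\<close> with a change of sign; for \<open>r = 2\<close> the argument already is \<open>1/3\<close>.\<close>

lemma sum_inverse_squares_third:
  assumes "0 < a"
  shows "pcong 1 (\<Sum>k | 3 * k \<le> p ^ a \<and> \<not> p dvd k. 1 / of_nat k ^ 2)
    (1 / 2 * of_int (Legendre (int p) 3) ^ a * bernoulli_poly (p - 2) (1 / 3))"
proof -
  define n where "n = p ^ a"
  define B where "B = bernoulli_poly (p - 2)"
  define N where "N = n div 3 + 1"
  define r where "r = n mod 3"
  have r: "r = 1 \<or> r = 2"
    using Legendre_3_power(2)[of a] by (simp add: r_def n_def)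
  have n3: "n = 3 * (n div 3) + r"
    by (simp add: r_def)
  have third: "1 / 3 \<in> Z"
    using Z_inverse_nat[OF not_p_dvd_3] by simp
  have set: "{k. 3 * k \<le> n \<and> \<not> p dvd k} = {k. k < N \<and> \<not> p dvd k}"
    unfolding N_def by auto
  have NZ: "pcong 1 (of_nat N) (1 - of_nat r * (1 / 3))"
  proof (rule pcongI)
    have "n = p * p ^ (a - 1)"
      using assms unfolding n_def by (cases a) simp_all
    then have "(of_nat p ^ 1 * (1 / 3 * of_nat (p ^ (a - 1))) :: rat) = of_nat n / 3"
      by simp
    also have "(of_nat n :: rat) = 3 * of_nat (n div 3) + of_nat r"
      by (subst n3) simp
    finally show "of_nat N - (1 - of_nat r * (1 / 3)) = (of_nat p ^ 1 * (1 / 3 * of_nat (p ^ (a - 1))) :: rat)"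
      by (simp add: N_def field_simps)
    show "1 / 3 * of_nat (p ^ (a - 1)) \<in> Z"
      by (intro Z_mult third Z_of_nat)
  qed
  have "pcong 1 (\<Sum>k | 3 * k \<le> n \<and> \<not> p dvd k. 1 / of_nat k ^ 2) (- B (1 - of_nat r * (1 / 3)) / 2)"
    unfolding set B_def by (intro sum_inverse_squares_pcong NZ Z_diff Z_1 Z_mult Z_of_nat third)
  also have "- B (1 - of_nat r * (1 / 3)) / 2 = 1 / 2 * of_int (Legendre (int p) 3) ^ a * B (1 / 3)"
  proof -
    have "odd (p - 2)"
      using odd_p p_gt_3 by simp
    then have "B (1 - 1 / 3) = - B (1 / 3)"
      unfolding B_def bernoulli_poly_reflect by simp
    moreover have "of_int (Legendre (int p) 3) ^ a = (if r = 1 then 1 else -1 :: rat)"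
      unfolding of_int_power [symmetric] Legendre_3_power(1) r_def n_def by simp
    moreover have "1 - of_nat 2 * (1 / 3) = (1 / 3 :: rat)"
      by simp
    ultimately show ?thesis
      using r by (elim disjE) simp_all
  qed
  finally show ?thesis
    unfolding n_def B_def .
qed

text \<open>The indices divisible by \<open>p\<close> in the sum for \<open>p\<^bsup>b + 1\<^esup>\<close> are exactly the \<open>p q\<close> with \<open>q\<close> an index in the
  sum for \<open>p\<^sup>b\<close>, which makes the termwise cancellation possible.\<close>

lemma central_trinomial_diff:
  "central_trinomial (p * p ^ b) - central_trinomial (p ^ b) =
    (\<Sum>k | 3 * k \<le> p * p ^ b \<and> \<not> p dvd k. trinomial_term (p * p ^ b) k) +
    (\<Sum>q | 3 * q \<le> p ^ b. trinomial_term (p * p ^ b) (p * q) - trinomial_term (p ^ b) q)"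
proof -
  let ?m = "p ^ b"
  let ?t = "trinomial_term (p * ?m)"
  have p0: "p > 0"
    using p_gt_3 by simp
  have fin: "finite {k :: nat. 3 * k \<le> c}" for c
    by (rule finite_subset[of _ "{..c}"]) auto
  have split: "{k. 3 * k \<le> p * ?m} = {k. 3 * k \<le> p * ?m \<and> \<not> p dvd k} \<union> (\<lambda>q. p * q) ` {q. 3 * q \<le> ?m}"
  proof (intro equalityI subsetI)
    fix k
    assume k: "k \<in> {k. 3 * k \<le> p * ?m}"
    show "k \<in> {k. 3 * k \<le> p * ?m \<and> \<not> p dvd k} \<union> (\<lambda>q. p * q) ` {q. 3 * q \<le> ?m}"
    proof (cases "p dvd k")
      case True
      then obtain q where q: "k = p * q"
        by (rule dvdE)
      then have "p * (3 * q) \<le> p * ?m"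
        using k by simp
      then have "3 * q \<le> ?m"
        using p0 by (simp only: mult_le_cancel1)
      then show ?thesis
        using q by blast
    qed (use k in simp)
  next
    fix k
    assume "k \<in> {k. 3 * k \<le> p * ?m \<and> \<not> p dvd k} \<union> (\<lambda>q. p * q) ` {q. 3 * q \<le> ?m}"
    then show "k \<in> {k. 3 * k \<le> p * ?m}"
      by (auto simp: mult.left_commute[of 3 p])
  qed
  have "central_trinomial (p * ?m) = (\<Sum>k | 3 * k \<le> p * ?m. ?t k)"
    using p0 by (intro central_trinomial_alternating) simp
  also have "\<dots> = (\<Sum>k | 3 * k \<le> p * ?m \<and> \<not> p dvd k. ?t k) + (\<Sum>k\<in>(\<lambda>q. p * q) ` {q. 3 * q \<le> ?m}. ?t k)"
    unfolding split
    by (rule sum.union_disjoint) (auto intro: fin finite_subset[OF _ fin[of "p * ?m"]])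
  also have "(\<Sum>k\<in>(\<lambda>q. p * q) ` {q. 3 * q \<le> ?m}. ?t k) = (\<Sum>q | 3 * q \<le> ?m. ?t (p * q))"
    using p0 by (subst sum.reindex) (auto simp: inj_on_def)
  finally show ?thesis
    using p0 by (simp add: sum_subtractf central_trinomial_alternating[of "p ^ b"])
qed

end

theorem corollary1:
  fixes p a :: nat
  assumes "prime p" and "p > 3" and "a > 0"
  shows "rat_cong
    (of_int (central_trinomial (p ^ a) - central_trinomial (p ^ (a - 1))) / of_nat p ^ (2 * a))
    (1 / 6 * of_int (Legendre (int p) 3) ^ a * bernoulli_poly (p - 2) (1 / 3))
    p"
proof -
  interpret prime_above_3 p
    using assms by unfold_locales
  obtain b where b: "a = Suc b"
    using assms(3) by (cases a) auto
  let ?n = "p ^ a" and ?m = "p ^ b"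
  let ?A = "{k. 3 * k \<le> ?n \<and> \<not> p dvd k}"
  let ?D = "\<lambda>q. of_int (trinomial_term ?n (p * q) - trinomial_term ?m q) / of_nat ?n ^ 2 :: rat"
  have n: "?n = p * ?m" and n2: "(of_nat p :: rat) ^ (2 * a) = of_nat ?n ^ 2"
    by (simp_all add: b mult_2 power_add power2_eq_square)
  have n0: "(of_nat ?n :: rat) \<noteq> 0"
    using assms(2) by simp
  have third: "1 / 3 \<in> Z"
    using Z_inverse_nat[OF not_p_dvd_3] by simp
  have "of_int (central_trinomial ?n - central_trinomial ?m) / of_nat p ^ (2 * a) =
      (\<Sum>k\<in>?A. of_int (trinomial_term ?n k) / of_nat ?n ^ 2) + (\<Sum>q | 3 * q \<le> ?m. ?D q)"
    unfolding n2 unfolding n central_trinomial_diff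
    by (simp only: of_int_add of_int_sum add_divide_distrib sum_divide_distrib)
  also have "pcong 1 \<dots> ((\<Sum>k\<in>?A. 1 / 3 * (1 / of_nat k ^ 2)) + (\<Sum>q | 3 * q \<le> ?m. 0))"
  proof (intro pcong_add pcong_sum)
    fix k
    assume "k \<in> ?A"
    then have "\<not> p dvd k" "3 * k < ?n"
      using three_mult_neq_prime_power[of k a] by auto
    then show "pcong 1 (of_int (trinomial_term ?n k) / of_nat ?n ^ 2) (1 / 3 * (1 / of_nat k ^ 2))"
      by (rule trinomial_term_coprime)
  next
    fix q
    assume "q \<in> {q. 3 * q \<le> ?m}"
    then have "3 * q < ?m"
      using three_mult_neq_prime_power[of q b] by auto
    then obtain z where z: "z \<in> Z" "of_int (trinomial_term ?n (p * q)) - of_int (trinomial_term ?m q) = of_nat p ^ (2 * b + 3) * z"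
      using trinomial_term_mult_p_pcong[of q b] unfolding n pcong_def by blast
    have "2 * b + 3 = 2 * a + 1"
      by (simp add: b)
    then have "(of_nat p :: rat) ^ (2 * b + 3) = of_nat ?n ^ 2 * of_nat p"
      by (simp only: n2 power_add power_one_right)
    then have "?D q = of_nat p ^ 1 * z"
      using n0 z(2) by simp
    then show "pcong 1 (?D q) 0"
      unfolding pcong_0_iff using z(1) by blast
  qed
  also have "(\<Sum>k\<in>?A. 1 / 3 * (1 / of_nat k ^ 2)) + (\<Sum>q | 3 * q \<le> ?m. 0) = 1 / 3 * (\<Sum>k\<in>?A. 1 / of_nat k ^ 2 :: rat)"
    by (simp only: sum_distrib_left sum.neutral_const add_0_right)
  also have "pcong 1 \<dots> (1 / 3 * (1 / 2 * of_int (Legendre (int p) 3) ^ a * bernoulli_poly (p - 2) (1 / 3)))"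
    by (intro pcong_cmult sum_inverse_squares_third third assms)
  finally have "pcong 1 (of_int (central_trinomial ?n - central_trinomial ?m) / of_nat p ^ (2 * a))
      (1 / 6 * of_int (Legendre (int p) 3) ^ a * bernoulli_poly (p - 2) (1 / 3))"
    by (simp only: mult.assoc [symmetric], simp)
  then show ?thesis
    unfolding rat_cong_iff_pcong by (simp add: b)
qed

end
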